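(* Let $N\ge 1$ and consider the leader-follower system on the $N\times N\times N$ 3D directed lattice, $\dot{\mathbf{x}} = -L_3\mathbf{x} + d$, where $L_3 \in \mathbb{R}^{N^3\times N^3}$ is the lower triangular block Toeplitz matrix, with $N^2\times N^2$ blocks, having $K$ on the main block diagonal, $-I$ on the first block subdiagonal and $0$ in every other block; $K\in\mathbb{R}^{N^2\times N^2}$ is the lower triangular block Toeplitz matrix, with $N\times N$ blocks, having $K_3$ on the main block diagonal, $-I$ on the first block subdiagonal and $0$ in every other block; and $K_3\in\mathbb{R}^{N\times N}$ is the lower triangular Toeplitz matrix with $3$ on the main diagonal, $-1$ on the first subdiagonal, and $0$ everywhere else. Let $P = \int_0^\infty e^{-L_3 t} e^{-L_3^T t}\,dt$ be the steady-state covariance matrix, let $P_n\in\mathbb{R}^{N^2\times N^2}$ be its $n$th diagonal block, $(P_n)_m \in\mathbb{R}^{N\times N}$ the $m$th diagonal block of $P_n$, and $((P_n)_m)_l$ the $l$th diagonal element of $(P_n)_m$. Then the steady-state variance of the follower at coordinates $(n,m,l)$ is $$((P_n)_m)_l = \sum_{i=1}^n\sum_{j=1}^m\sum_{k=1}^l \frac{6^{6-(2i+2j+2k)}\,(2i+2j+2k-6)!}{6\,\bigl((i-1)!\,(j-1)!\,(k-1)!\bigr)^2}, \qquad n,m,l=1,\ldots,N.$$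
   Context: The 3D leader-follower system has followers indexed by $(n,m,l)$, $1\le n,m,l\le N$, with scalar states obeying $\dot{x}_{n,m,l} = -(x_{n,m,l}-x_{n-1,m,l}) - (x_{n,m,l}-x_{n,m-1,l}) - (x_{n,m,l}-x_{n,m,l-1}) + d_{n,m,l}$, with boundary values $x_{0,m,l}=x_{n,0,l}=x_{n,m,0}=x_0\equiv 0$ (the leader's state). Stacking the states gives $\dot{\mathbf{x}}=-L_3\mathbf{x}+d$ with $L_3$ as in the claim. The disturbance $d$ is zero-mean, unit-variance white noise, uncorrelated across followers (identity intensity matrix), so the steady-state covariance $\lim_{t\to\infty}E\{\mathbf{x}(t)\mathbf{x}^T(t)\}$ equals $P=\int_0^\infty e^{-L_3 t}e^{-L_3^T t}\,dt$. The steady-state variance of follower $(n,m,l)$ is the corresponding diagonal entry $((P_n)_m)_l$ of $P$. *)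

theory Defs
  imports "HOL-Analysis.Analysis" "Jordan_Normal_Form.Matrix"
begin

text \<open>
  Matrices are those of \<^typ>\<open>real mat\<close>, indexed from 0, because the dimension \<open>N ^ 3\<close> depends on
  the variable \<open>N\<close>. Blocks are numbered from 1: block \<open>n\<close> of size \<open>s\<close> occupies the
  0-based indices from \<open>(n - 1) * s\<close> up to (and excluding) \<open>n * s\<close>.
\<close>

definition block_toeplitz :: "nat \<Rightarrow> real mat \<Rightarrow> real mat" where
  "block_toeplitz N A =
    (let s = dim_row A in
      mat (N * s) (N * s) (\<lambda>(i, j).
        (if i div s = j div s then A
         else if i div s = Suc (j div s) then - 1\<^sub>m s
         else 0\<^sub>m s s) $$ (i mod s, j mod s)))"

definition K3 :: "nat \<Rightarrow> real mat" where
  "K3 N = mat N N (\<lambda>(i, j). if i = j then 3 else if i = Suc j then - 1 else 0)"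

definition K :: "nat \<Rightarrow> real mat" where
  "K N = block_toeplitz N (K3 N)"

definition L3 :: "nat \<Rightarrow> real mat" where
  "L3 N = block_toeplitz N (K N)"

text \<open>The exponential series \<open>\<Sum>k. A ^ k / k!\<close>, taken entrywise; for square \<open>A\<close>.\<close>

definition mat_exp :: "real mat \<Rightarrow> real mat" where
  "mat_exp A = mat (dim_row A) (dim_row A) (\<lambda>(i, j). \<Sum>k. (A ^\<^sub>m k) $$ (i, j) / fact k)"

text \<open>
  The steady-state covariance of \<open>x' = - A x + d\<close>, where \<open>d\<close> is white noise with identity
  intensity: the entrywise integral of \<open>exp (- A t) exp (- A\<^sup>T t)\<close> over the half-line.
\<close>

definition steady_state_cov :: "real mat \<Rightarrow> real mat" where
  "steady_state_cov A = mat (dim_row A) (dim_row A) (\<lambda>(i, j).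
     integral {0..} (\<lambda>t. (mat_exp ((- t) \<cdot>\<^sub>m A) * mat_exp ((- t) \<cdot>\<^sub>m A\<^sup>T)) $$ (i, j)))"

definition diag_block :: "nat \<Rightarrow> real mat \<Rightarrow> nat \<Rightarrow> real mat" where
  "diag_block s P n = mat s s (\<lambda>(i, j). P $$ ((n - 1) * s + i, (n - 1) * s + j))"

definition diag_elem :: "real mat \<Rightarrow> nat \<Rightarrow> real" where
  "diag_elem P l = P $$ (l - 1, l - 1)"

lemma dim_block_toeplitz [simp]:
  "dim_row (block_toeplitz N A) = N * dim_row A" "dim_col (block_toeplitz N A) = N * dim_row A"
  by (simp_all add: block_toeplitz_def Let_def)

lemma K3_carrier: "K3 N \<in> carrier_mat N N"
  by (simp add: K3_def)

lemma K_carrier: "K N \<in> carrier_mat (N\<^sup>2) (N\<^sup>2)"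
  using K3_carrier[of N] by (auto simp: K_def power2_eq_square)

lemma L3_carrier: "L3 N \<in> carrier_mat (N ^ 3) (N ^ 3)"
  using K_carrier[of N] by (auto simp: L3_def power2_eq_square power3_eq_cube)

lemma sum_blocks:
  fixes f :: "nat \<Rightarrow> 'a :: comm_monoid_add"
  shows "(\<Sum>j<N * s. f j) = (\<Sum>p<N. \<Sum>r<s. f (p * s + r))"
proof -
  have "sum f {p * s..<p * s + s} = (\<Sum>r<s. f (p * s + r))" for p
    by (subst sum.atLeastLessThan_shift_0) (simp add: lessThan_atLeast0)
  then show ?thesis
    by (simp flip: sum.nat_group)
qed

lemma block_toeplitz_mult_vec:
  assumes A: "A \<in> carrier_mat s s" and v: "v \<in> carrier_vec (N * s)" and p: "p < N" and q: "q < s"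
  shows "(block_toeplitz N A *\<^sub>v v) $ (p * s + q) =
    (A *\<^sub>v vec s (\<lambda>r. v $ (p * s + r))) $ q - (if p = 0 then 0 else v $ ((p - 1) * s + q))"
proof -
  have bnd: "b * s + r < N * s" if "b < N" "r < s" for b r
  proof -
    have "b * s + r < Suc b * s" using that by simp
    also have "\<dots> \<le> N * s" using that by (intro mult_le_mono1) simp
    finally show ?thesis .
  qed
  let ?B = "\<lambda>b. if p = b then A else if p = Suc b then - 1\<^sub>m s else 0\<^sub>m s s"
  have s: "dim_row A = s" "dim_col A = s" using A by auto
  have "(block_toeplitz N A *\<^sub>v v) $ (p * s + q) =
      (\<Sum>j<N * s. block_toeplitz N A $$ (p * s + q, j) * v $ j)"
    using v bnd[OF p q] by (simp add: scalar_prod_def s lessThan_atLeast0)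
  also have "\<dots> = (\<Sum>b<N. \<Sum>r<s. ?B b $$ (q, r) * v $ (b * s + r))"
    unfolding sum_blocks
    by (intro sum.cong refl) (use q bnd p in \<open>simp add: block_toeplitz_def s Let_def\<close>)
  also have "\<dots> = (\<Sum>b<N. (if b = p then (A *\<^sub>v vec s (\<lambda>r. v $ (p * s + r))) $ q else 0)
      - (if Suc b = p then v $ (b * s + q) else 0))"
  proof (intro sum.cong refl)
    fix b
    have "(\<Sum>r<s. (- 1\<^sub>m s) $$ (q, r) * v $ (b * s + r)) =
        (\<Sum>r<s. if r = q then - v $ (b * s + r) else 0)"
      by (intro sum.cong refl) (use q in auto)
    then show "(\<Sum>r<s. ?B b $$ (q, r) * v $ (b * s + r)) =
        (if b = p then (A *\<^sub>v vec s (\<lambda>r. v $ (p * s + r))) $ q else 0)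
        - (if Suc b = p then v $ (b * s + q) else 0)"
      using q s by (auto simp: scalar_prod_def lessThan_atLeast0)
  qed
  also have "\<dots> = (A *\<^sub>v vec s (\<lambda>r. v $ (p * s + r))) $ q
      - (if p = 0 then 0 else v $ ((p - 1) * s + q))"
    using p by (cases p) (simp_all add: sum_subtractf)
  finally show ?thesis .
qed

lemma K3_mult_vec:
  assumes v: "v \<in> carrier_vec N" and q: "q < N"
  shows "(K3 N *\<^sub>v v) $ q = 3 * v $ q - (if q = 0 then 0 else v $ (q - 1))"
proof -
  have "(K3 N *\<^sub>v v) $ q =
      (\<Sum>j<N. (if j = q then 3 * v $ q else 0) - (if Suc j = q then v $ j else 0))"
    using v q by (auto simp: K3_def scalar_prod_def lessThan_atLeast0 intro!: sum.cong)
  also have "\<dots> = 3 * v $ q - (if q = 0 then 0 else v $ (q - 1))"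
    using q by (cases q) (simp_all add: sum_subtractf)
  finally show ?thesis .
qed

text \<open>
  The vector field \<open>x \<mapsto> - L3 x\<close> is the leader-follower dynamics on the lattice, with the state
  of follower \<open>(n, m, l)\<close> at index \<open>(n - 1) N\<^sup>2 + (m - 1) N + (l - 1)\<close> and the leader at 0.
\<close>

lemma L3_dynamics:
  fixes x :: "nat \<Rightarrow> nat \<Rightarrow> nat \<Rightarrow> real"
  assumes v: "v \<in> carrier_vec (N ^ 3)"
    and stack: "\<And>n m l. n \<in> {1..N} \<Longrightarrow> m \<in> {1..N} \<Longrightarrow> l \<in> {1..N} \<Longrightarrow>
      v $ ((n - 1) * N\<^sup>2 + ((m - 1) * N + (l - 1))) = x n m l"
    and leader: "\<And>a b. x 0 a b = 0" "\<And>a b. x a 0 b = 0" "\<And>a b. x a b 0 = 0"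
    and n: "n \<in> {1..N}" and m: "m \<in> {1..N}" and l: "l \<in> {1..N}"
  shows "(- (L3 N *\<^sub>v v)) $ ((n - 1) * N\<^sup>2 + ((m - 1) * N + (l - 1))) =
    - (x n m l - x (n - 1) m l) - (x n m l - x n (m - 1) l) - (x n m l - x n m (l - 1))"
proof -
  have bnd: "b * s + r < M * s" if "b < M" "r < s" for b r s M :: nat
  proof -
    have "b * s + r < Suc b * s" using that by simp
    also have "\<dots> \<le> M * s" using that by (intro mult_le_mono1) simp
    finally show ?thesis .
  qed
  obtain n' m' l' where Suc: "n = Suc n'" "m = Suc m'" "l = Suc l'"
    using n m l by (metis atLeastAtMost_iff not_one_le_zero old.nat.exhaust)
  then have less: "n' < N" "m' < N" "l' < N"
    using n m l by auto
  have lt: "m' * N + l' < N\<^sup>2"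
    using bnd[OF less(2,3)] by (simp add: power2_eq_square)
  have lt3: "n' * N\<^sup>2 + (m' * N + l') < N ^ 3"
    using bnd[OF less(1) lt] by (simp add: power2_eq_square power3_eq_cube)
  have stack': "v $ (a * N\<^sup>2 + (b * N + c)) = x (Suc a) (Suc b) (Suc c)"
    if "a < N" "b < N" "c < N" for a b c
    using stack[of "Suc a" "Suc b" "Suc c"] that by simp
  define w where "w = vec (N\<^sup>2) (\<lambda>r. v $ (n' * N\<^sup>2 + r))"
  define u where "u = vec N (\<lambda>r. w $ (m' * N + r))"
  have w: "w \<in> carrier_vec (N * N)" by (simp add: w_def power2_eq_square)
  have u: "u \<in> carrier_vec N" by (simp add: u_def)
  have v': "v \<in> carrier_vec (N * N\<^sup>2)"
    using v by (simp add: power2_eq_square power3_eq_cube mult.assoc)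
  have w_eq: "w $ (b * N + c) = x n (Suc b) (Suc c)" if "b < N" "c < N" for b c
    using bnd[OF that] stack'[OF less(1) that] by (simp add: w_def Suc power2_eq_square)
  have u_eq: "u $ c = x n m (Suc c)" if "c < N" for c
    using that w_eq[OF less(2) that] by (simp add: u_def Suc)
  have "(L3 N *\<^sub>v v) $ (n' * N\<^sup>2 + (m' * N + l')) = (K N *\<^sub>v w) $ (m' * N + l') - x n' m l"
    unfolding L3_def block_toeplitz_mult_vec[OF K_carrier v' less(1) lt] w_def[symmetric]
    using stack'[of "n' - 1" m' l'] less leader Suc by (cases n') simp_all
  also have "(K N *\<^sub>v w) $ (m' * N + l') = (K3 N *\<^sub>v u) $ l' - x n m' l"
    unfolding K_def block_toeplitz_mult_vec[OF K3_carrier w less(2,3)] u_def[symmetric]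
    using w_eq[of "m' - 1" l'] less leader Suc by (cases m') simp_all
  also have "(K3 N *\<^sub>v u) $ l' = 3 * x n m l - x n m l'"
    unfolding K3_mult_vec[OF u less(3)]
    using u_eq[of l'] u_eq[of "l' - 1"] less leader Suc by (cases l') simp_all
  finally show ?thesis
    using lt3 L3_carrier[of N] by (simp add: Suc)
qed

end

theory Submission
  imports Defs "HOL-Probability.Distributions"
begin

text \<open>
  Writing \<open>L\<^sub>3 = 3 I - S\<^sub>1 - S\<^sub>2 - S\<^sub>3\<close> with commuting nilpotent shifts \<open>S\<^sub>i\<close> along the three axes,
  one expects \<open>exp (- t L\<^sub>3) = e\<^sup>-\<^sup>3\<^sup>t exp (t S\<^sub>1) exp (t S\<^sub>2) exp (t S\<^sub>3)\<close>: the response at site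
  \<open>(n, m, l)\<close> to a unit impulse at site \<open>(p, q, r)\<close> is
  \<open>t\<^sup>d e\<^sup>-\<^sup>3\<^sup>t / (a! b! c!)\<close>, where \<open>a = n - p\<close>, \<open>b = m - q\<close>, \<open>c = l - r\<close> and \<open>d = a + b + c\<close>, and it is 0
  unless \<open>a\<close>, \<open>b\<close>, \<open>c\<close> are all nonnegative.

  This is proved on the level of Taylor coefficients, which avoids the block decomposition of the
  shifts. Multiplication by \<open>- L\<^sub>3\<close> is the right-hand side of the lattice dynamics
  (\<open>L3_dynamics\<close>), and the Taylor coefficients of the claimed response satisfy the same
  recursion in \<open>k\<close> (\<open>response_coeff_Suc\<close>), hence agree with the columns of
  \<open>(- L\<^sub>3)\<^sup>k / k!\<close> (\<open>L3_pow_entry\<close>).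

  The variance at \<open>(n, m, l)\<close> is then the integral of the sum of the squared responses over all
  sources \<open>(p, q, r)\<close>, and each square contributes
  \<open>\<integral> t\<^sup>2\<^sup>d e\<^sup>-\<^sup>6\<^sup>t dt = (2 d)! / 6\<^sup>2\<^sup>d\<^sup>+\<^sup>1\<close> divided by \<open>(a! b! c!)\<^sup>2\<close>. Counting sources by their
  distance, \<open>i = a + 1\<close>, \<open>j = b + 1\<close>, \<open>k = c + 1\<close>, gives the formula.
\<close>

section \<open>Powers and exponentials of square matrices\<close>

lemma pow_mat_Suc_left:
  fixes A :: "'a :: semiring_1 mat"
  assumes "A \<in> carrier_mat n n"
  shows "A ^\<^sub>m Suc k = A * A ^\<^sub>m k"
proof (induction k)
  case 0
  then show ?case using assms by simp
next
  case (Suc k)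
  have "A ^\<^sub>m Suc (Suc k) = (A * A ^\<^sub>m k) * A"
    using Suc by simp
  also have "\<dots> = A * A ^\<^sub>m Suc k"
    using assms by (simp add: assoc_mult_mat[of _ n n _ n _ n])
  finally show ?case .
qed

lemma transpose_pow_mat:
  fixes A :: "'a :: comm_semiring_1 mat"
  assumes "A \<in> carrier_mat n n"
  shows "A\<^sup>T ^\<^sub>m k = (A ^\<^sub>m k)\<^sup>T"
proof (induction k)
  case 0
  then show ?case using assms by simp
next
  case (Suc k)
  have "A\<^sup>T ^\<^sub>m Suc k = (A ^\<^sub>m k)\<^sup>T * A\<^sup>T"
    using Suc by simp
  also have "\<dots> = (A ^\<^sub>m Suc k)\<^sup>T"
    unfolding pow_mat_Suc_left[OF assms]
    using assms by (simp add: transpose_mult[of _ n n _ n])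
  finally show ?case .
qed

lemma mat_exp_transpose:
  assumes "A \<in> carrier_mat n n"
  shows "mat_exp A\<^sup>T = (mat_exp A)\<^sup>T"
  using assms
  by (intro eq_matI) (auto simp: mat_exp_def transpose_pow_mat[OF assms] carrier_matD[OF assms])

section \<open>The stacked index\<close>

text \<open>
  The 0-based position of the state of follower \<open>(n, m, l)\<close>, with 1-based coordinates, in the
  stacked vector.
\<close>

definition stacked_index :: "nat \<Rightarrow> nat \<Rightarrow> nat \<Rightarrow> nat \<Rightarrow> nat" where
  "stacked_index N n m l = (n - 1) * N\<^sup>2 + ((m - 1) * N + (l - 1))"

lemma block_index_less:
  fixes b r s M :: nat
  assumes "b < M" "r < s"
  shows "b * s + r < M * s"
proof -
  have "b * s + r < Suc b * s" using assms by simp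
  also have "\<dots> \<le> M * s" using assms by (intro mult_le_mono1) simp
  finally show ?thesis .
qed

lemma block_index_eq_iff:
  fixes b b' r r' s :: nat
  assumes "r < s" "r' < s"
  shows "b * s + r = b' * s + r' \<longleftrightarrow> b = b' \<and> r = r'"
proof
  assume eq: "b * s + r = b' * s + r'"
  have "b = (b * s + r) div s" "b' = (b' * s + r') div s"
    using assms by simp_all
  with eq show "b = b' \<and> r = r'" by simp
qed simp

context
  fixes N n m l :: nat
  assumes nml: "n \<in> {1..N}" "m \<in> {1..N}" "l \<in> {1..N}"
begin

lemma plane_index_less: "(m - 1) * N + (l - 1) < N\<^sup>2"
  using block_index_less[of "m - 1" N "l - 1" N] nml by (auto simp: power2_eq_square)

lemma stacked_index_less: "stacked_index N n m l < N ^ 3"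
  using block_index_less[of "n - 1" N "(m - 1) * N + (l - 1)" "N\<^sup>2"] nml plane_index_less
  by (auto simp: stacked_index_def power2_eq_square power3_eq_cube mult.assoc)

lemma stacked_index_eq_iff:
  assumes "p \<in> {1..N}" "q \<in> {1..N}" "r \<in> {1..N}"
  shows "stacked_index N n m l = stacked_index N p q r \<longleftrightarrow> n = p \<and> m = q \<and> l = r"
proof -
  have "(q - 1) * N + (r - 1) < N\<^sup>2"
    using block_index_less[of "q - 1" N "r - 1" N] assms by (auto simp: power2_eq_square)
  moreover have "l - 1 < N" "r - 1 < N"
    using nml assms by auto
  ultimately have "stacked_index N n m l = stacked_index N p q r \<longleftrightarrow>
      n - 1 = p - 1 \<and> m - 1 = q - 1 \<and> l - 1 = r - 1"
    unfolding stacked_index_def using plane_index_less by (simp only: block_index_eq_iff)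
  with nml assms show ?thesis
    by auto
qed

lemma diag_elem_diag_block:
  "diag_elem (diag_block N (diag_block (N\<^sup>2) P n) m) l =
    P $$ (stacked_index N n m l, stacked_index N n m l)"
proof -
  have "l - 1 < N" using nml by auto
  then show ?thesis
    using plane_index_less by (simp add: diag_elem_def diag_block_def stacked_index_def)
qed

end

lemma sum_stacked_index:
  fixes f :: "nat \<Rightarrow> 'a :: comm_monoid_add"
  shows "(\<Sum>j<N ^ 3. f j) = (\<Sum>p=1..N. \<Sum>q=1..N. \<Sum>r=1..N. f (stacked_index N p q r))"
proof -
  have "(\<Sum>j<N ^ 3. f j) = (\<Sum>p<N. \<Sum>j<N\<^sup>2. f (p * N\<^sup>2 + j))"
    using sum_blocks[of f N "N\<^sup>2"] by (simp add: power2_eq_square power3_eq_cube mult.assoc)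
  also have "\<dots> = (\<Sum>p<N. \<Sum>q<N. \<Sum>r<N. f (p * N\<^sup>2 + (q * N + r)))"
    by (simp add: power2_eq_square sum_blocks)
  finally show ?thesis
    by (simp add: sum.atLeast1_atMost_eq stacked_index_def)
qed

section \<open>The impulse response and its Taylor coefficients\<close>

text \<open>The coefficient of \<open>t\<^sup>k\<close> in \<open>t\<^sup>d exp (- 3 t)\<close>.\<close>

definition decay_coeff :: "nat \<Rightarrow> nat \<Rightarrow> real" where
  "decay_coeff d k = (if k < d then 0 else (- 3) ^ (k - d) / fact (k - d))"

text \<open>
  The response at site \<open>(n, m, l)\<close>, at time \<open>t\<close>, to a unit impulse at site \<open>(p, q, r)\<close>, and its
  coefficient of \<open>t\<^sup>k\<close>. Both vanish when a coordinate \<open>n\<close>, \<open>m\<close>, or \<open>l\<close> is 0 (the leader) and the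
  source has positive coordinates.
\<close>

definition response :: "nat \<Rightarrow> nat \<Rightarrow> nat \<Rightarrow> nat \<Rightarrow> nat \<Rightarrow> nat \<Rightarrow> real \<Rightarrow> real" where
  "response p q r n m l t =
    (if p \<le> n \<and> q \<le> m \<and> r \<le> l
     then t ^ ((n - p) + (m - q) + (l - r)) * exp (- 3 * t)
       / (fact (n - p) * fact (m - q) * fact (l - r))
     else 0)"

definition response_coeff :: "nat \<Rightarrow> nat \<Rightarrow> nat \<Rightarrow> nat \<Rightarrow> nat \<Rightarrow> nat \<Rightarrow> nat \<Rightarrow> real" where
  "response_coeff p q r n m l k =
    (if p \<le> n \<and> q \<le> m \<and> r \<le> l
     then decay_coeff ((n - p) + (m - q) + (l - r)) k
       / (fact (n - p) * fact (m - q) * fact (l - r))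
     else 0)"

lemma sums_decay_coeff: "(\<lambda>k. decay_coeff d k * t ^ k) sums (t ^ d * exp (- 3 * t))"
proof -
  have "(\<lambda>k. (- 3 * t) ^ k /\<^sub>R fact k) sums exp (- 3 * t)"
    by (rule exp_converges)
  then have "(\<lambda>k. t ^ d * ((- 3 * t) ^ k /\<^sub>R fact k)) sums (t ^ d * exp (- 3 * t))"
    by (rule sums_mult)
  also have "(\<lambda>k. t ^ d * ((- 3 * t) ^ k /\<^sub>R fact k)) = (\<lambda>k. decay_coeff d (k + d) * t ^ (k + d))"
    by (rule ext) (simp add: decay_coeff_def power_add power_mult_distrib[of "- 3" t, simplified]
        divide_inverse)
  finally show ?thesis
    by (subst (asm) sums_iff_shift) (simp add: decay_coeff_def)
qed

lemma sums_response_coeff: "(\<lambda>k. response_coeff p q r n m l k * t ^ k) sums response p q r n m l t"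
proof (cases "p \<le> n \<and> q \<le> m \<and> r \<le> l")
  case True
  define d where "d = (n - p) + (m - q) + (l - r)"
  define f :: real where "f = fact (n - p) * fact (m - q) * fact (l - r)"
  have "(\<lambda>k. decay_coeff d k * t ^ k / f) sums (t ^ d * exp (- 3 * t) / f)"
    by (intro sums_divide sums_decay_coeff)
  moreover have "response_coeff p q r n m l k * t ^ k = decay_coeff d k * t ^ k / f" for k
    using True by (simp add: response_coeff_def d_def f_def)
  moreover have "response p q r n m l t = t ^ d * exp (- 3 * t) / f"
    using True by (simp add: response_def d_def f_def)
  ultimately show ?thesis by simp
next
  case False
  then show ?thesis by (auto simp: response_coeff_def response_def)
qed

text \<open>Comparing coefficients in \<open>(t\<^sup>d e\<^sup>-\<^sup>3\<^sup>t)' = - 3 t\<^sup>d e\<^sup>-\<^sup>3\<^sup>t + d t\<^sup>d\<^sup>-\<^sup>1 e\<^sup>-\<^sup>3\<^sup>t\<close>.\<close>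

lemma decay_coeff_Suc:
  "real (Suc k) * decay_coeff d (Suc k) = - 3 * decay_coeff d k + real d * decay_coeff (d - 1) k"
proof -
  consider "Suc k < d" | "d = Suc k" | e where "k = d + e"
    by (metis linorder_neqE_nat not_less_eq le_iff_add linorder_not_less)
  then show ?thesis
  proof cases
    case 1
    then show ?thesis by (simp add: decay_coeff_def)
  next
    case 2
    then show ?thesis by (simp add: decay_coeff_def)
  next
    case 3
    show ?thesis
    proof (cases d)
      case 0
      then show ?thesis using 3
        by (simp add: decay_coeff_def divide_simps del: of_nat_Suc)
    next
      case (Suc d')
      then show ?thesis using 3
        by (simp add: decay_coeff_def Suc_diff_le divide_simps) (simp add: algebra_simps)
    qed
  qed
qed

text \<open>The Taylor coefficients of the response satisfy the recursion given by the lattice dynamics.\<close>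

lemma response_coeff_Suc:
  assumes "p \<ge> 1" "q \<ge> 1" "r \<ge> 1"
  shows "real (Suc k) * response_coeff p q r n m l (Suc k) =
    - 3 * response_coeff p q r n m l k + response_coeff p q r (n - 1) m l k
    + response_coeff p q r n (m - 1) l k + response_coeff p q r n m (l - 1) k"
proof (cases "p \<le> n \<and> q \<le> m \<and> r \<le> l")
  case True
  then obtain a b c where abc: "n = p + a" "m = q + b" "l = r + c"
    by (auto simp: le_iff_add)
  let ?f = "fact a * fact b * fact c :: real"
  let ?x = "decay_coeff (a + b + c - 1) k"
  have "response_coeff p q r (n - 1) m l k = real a * ?x / ?f"
    using assms unfolding abc by (cases a) (simp_all add: response_coeff_def divide_simps)
  moreover have "response_coeff p q r n (m - 1) l k = real b * ?x / ?f"
    using assms unfolding abc by (cases b) (simp_all add: response_coeff_def divide_simps)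
  moreover have "response_coeff p q r n m (l - 1) k = real c * ?x / ?f"
    using assms unfolding abc by (cases c) (simp_all add: response_coeff_def divide_simps)
  moreover have "response_coeff p q r n m l i = decay_coeff (a + b + c) i / ?f" for i
    by (simp add: response_coeff_def abc)
  moreover have "real (Suc k) * decay_coeff (a + b + c) (Suc k) / ?f =
      (- 3 * decay_coeff (a + b + c) k + (real a + real b + real c) * ?x) / ?f"
    unfolding decay_coeff_Suc by simp
  ultimately show ?thesis
    by (simp add: add_divide_distrib diff_divide_distrib distrib_right)
next
  case False
  then show ?thesis by (auto simp: response_coeff_def)
qed

lemma response_coeff_0:
  "response_coeff p q r n m l 0 = (if n = p \<and> m = q \<and> l = r then 1 else 0)"
  by (auto simp: response_coeff_def decay_coeff_def)

lemma response_coeff_leader: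
  assumes "p \<ge> 1" "q \<ge> 1" "r \<ge> 1"
  shows "response_coeff p q r 0 m l k = 0" "response_coeff p q r n 0 l k = 0"
    "response_coeff p q r n m 0 k = 0"
  using assms by (auto simp: response_coeff_def)

lemma L3_pow_entry:
  assumes "n \<in> {1..N}" "m \<in> {1..N}" "l \<in> {1..N}"
    and pqr: "p \<in> {1..N}" "q \<in> {1..N}" "r \<in> {1..N}"
  shows "(((- t) \<cdot>\<^sub>m L3 N) ^\<^sub>m k) $$ (stacked_index N n m l, stacked_index N p q r) =
    fact k * t ^ k * response_coeff p q r n m l k"
  using assms(1-3)
proof (induction k arbitrary: n m l)
  case 0
  then show ?case
    using pqr L3_carrier[of N]
    by (simp add: stacked_index_less stacked_index_eq_iff response_coeff_0)
next
  case (Suc k)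
  let ?A = "(- t) \<cdot>\<^sub>m L3 N" and ?i = "stacked_index N n m l" and ?j = "stacked_index N p q r"
  let ?x = "\<lambda>n m l. fact k * t ^ k * response_coeff p q r n m l k"
  have A: "?A \<in> carrier_mat (N ^ 3) (N ^ 3)"
    using L3_carrier[of N] by simp
  note i = stacked_index_less[OF Suc.prems] and j = stacked_index_less[OF pqr]
  define v where "v = col (?A ^\<^sub>m k) ?j"
  have v: "v \<in> carrier_vec (N ^ 3)"
    using carrier_matD[OF L3_carrier[of N]] by (intro carrier_vecI) (simp add: v_def)
  have v_eq: "v $ ((n - 1) * N\<^sup>2 + ((m - 1) * N + (l - 1))) = ?x n m l"
    if "n \<in> {1..N}" "m \<in> {1..N}" "l \<in> {1..N}" for n m l
    using Suc.IH[OF that] stacked_index_less[OF that] j carrier_matD[OF L3_carrier[of N]]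
    by (simp add: v_def stacked_index_def)
  have dyn: "(- (L3 N *\<^sub>v v)) $ ?i = - (?x n m l - ?x (n - 1) m l)
      - (?x n m l - ?x n (m - 1) l) - (?x n m l - ?x n m (l - 1))"
    unfolding stacked_index_def
    by (rule L3_dynamics[OF v v_eq _ _ _ Suc.prems])
      (use pqr in \<open>simp_all add: response_coeff_leader\<close>)
  have "(?A ^\<^sub>m Suc k) $$ (?i, ?j) = (?A * ?A ^\<^sub>m k) $$ (?i, ?j)"
    by (simp only: pow_mat_Suc_left[OF A])
  also have "\<dots> = row ?A ?i \<bullet> v"
    unfolding v_def using carrier_matD[OF L3_carrier[of N]] i j
    by (subst index_mult_mat) simp_all
  also have "\<dots> = t * (- (L3 N *\<^sub>v v)) $ ?i"
    using L3_carrier[of N] i v by (simp add: row_smult)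
  also have "\<dots> = fact k * t ^ Suc k * (- 3 * response_coeff p q r n m l k
      + response_coeff p q r (n - 1) m l k + response_coeff p q r n (m - 1) l k
      + response_coeff p q r n m (l - 1) k)"
    unfolding dyn by (simp add: algebra_simps)
  also have "\<dots> = fact k * t ^ Suc k * (real (Suc k) * response_coeff p q r n m l (Suc k))"
    using pqr by (subst response_coeff_Suc) auto
  finally show ?case by (simp add: mult_ac)
qed

lemma mat_exp_L3_entry:
  assumes "n \<in> {1..N}" "m \<in> {1..N}" "l \<in> {1..N}" "p \<in> {1..N}" "q \<in> {1..N}" "r \<in> {1..N}"
  shows "mat_exp ((- t) \<cdot>\<^sub>m L3 N) $$ (stacked_index N n m l, stacked_index N p q r) =
    response p q r n m l t"
proof -
  have "mat_exp ((- t) \<cdot>\<^sub>m L3 N) $$ (stacked_index N n m l, stacked_index N p q r) =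
      (\<Sum>k. response_coeff p q r n m l k * t ^ k)"
    using assms L3_carrier[of N]
    by (simp add: mat_exp_def stacked_index_less L3_pow_entry mult_ac)
  also have "\<dots> = response p q r n m l t"
    by (rule sums_unique[symmetric], rule sums_response_coeff)
  finally show ?thesis .
qed

section \<open>Integration over time\<close>

lemma has_integral_power_exp:
  assumes "c > 0"
  shows "((\<lambda>t. t ^ k * exp (- c * t)) has_integral fact k / c ^ Suc k) {0 :: real..}"
proof -
  \<comment> \<open>Up to a constant factor, the integrand is the density of an Erlang distribution.\<close>
  have "(erlang_density k c has_integral 1) UNIV"
  proof (rule nn_integral_has_integral)
    show "(\<integral>\<^sup>+ x. ennreal (erlang_density k c x) \<partial>lborel) = ennreal 1"
      using nn_integral_erlang_ith_moment[OF assms, of k 0] by simp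
  qed (use assms in \<open>auto simp: erlang_density_nonneg\<close>)
  then have "((\<lambda>t. fact k / c ^ Suc k * erlang_density k c t) has_integral
      fact k / c ^ Suc k * 1) UNIV"
    by (rule has_integral_mult_right)
  moreover have "fact k / c ^ Suc k * erlang_density k c t =
      (if t \<in> {0..} then t ^ k * exp (- c * t) else 0)" for t
    using assms by (simp add: erlang_density_def)
  ultimately show ?thesis
    by (simp only: has_integral_restrict_UNIV mult_1_right)
qed

text \<open>The variance contributed by a unit-intensity source at distance \<open>a\<close>, \<open>b\<close>, \<open>c\<close> along the axes.\<close>

definition source_variance :: "nat \<Rightarrow> nat \<Rightarrow> nat \<Rightarrow> real" where
  "source_variance a b c =
    fact (2 * (a + b + c)) / (6 ^ (2 * (a + b + c) + 1) * (fact a * fact b * fact c)\<^sup>2)"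

lemma has_integral_response_squared:
  "((\<lambda>t. (response p q r n m l t)\<^sup>2) has_integral
    (if p \<le> n \<and> q \<le> m \<and> r \<le> l then source_variance (n - p) (m - q) (l - r) else 0)) {0..}"
proof (cases "p \<le> n \<and> q \<le> m \<and> r \<le> l")
  case True
  define d where "d = (n - p) + (m - q) + (l - r)"
  define f :: real where "f = fact (n - p) * fact (m - q) * fact (l - r)"
  have "((\<lambda>t. t ^ (2 * d) * exp (- 6 * t) / f\<^sup>2) has_integral
      fact (2 * d) / 6 ^ Suc (2 * d) / f\<^sup>2) {0..}"
    by (intro has_integral_divide has_integral_power_exp) simp
  moreover have "(response p q r n m l t)\<^sup>2 = t ^ (2 * d) * exp (- 6 * t) / f\<^sup>2" for t
  proof -
    have "(exp (- 3 * t))\<^sup>2 = exp (- 6 * t)"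
      by (simp flip: exp_double)
    moreover have "response p q r n m l t = t ^ d * exp (- 3 * t) / f"
      using True by (simp add: response_def d_def f_def)
    moreover have "(t ^ d)\<^sup>2 = t ^ (2 * d)"
      by (simp add: mult.commute flip: power_mult)
    ultimately show ?thesis
      by (simp only: power_divide power_mult_distrib)
  qed
  moreover have "source_variance (n - p) (m - q) (l - r) = fact (2 * d) / 6 ^ Suc (2 * d) / f\<^sup>2"
    by (simp add: source_variance_def d_def f_def)
  ultimately show ?thesis using True by simp
next
  case False
  then show ?thesis by (auto simp: response_def)
qed

lemma steady_state_cov_L3_diag:
  assumes nml: "n \<in> {1..N}" "m \<in> {1..N}" "l \<in> {1..N}"
  shows "steady_state_cov (L3 N) $$ (stacked_index N n m l, stacked_index N n m l) =
    (\<Sum>p=1..N. \<Sum>q=1..N. \<Sum>r=1..N.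
      if p \<le> n \<and> q \<le> m \<and> r \<le> l then source_variance (n - p) (m - q) (l - r) else 0)"
    (is "_ = ?V")
proof -
  let ?i = "stacked_index N n m l"
  have L: "L3 N \<in> carrier_mat (N ^ 3) (N ^ 3)"
    by (rule L3_carrier)
  note i = stacked_index_less[OF nml]
  have integrand: "(mat_exp ((- t) \<cdot>\<^sub>m L3 N) * mat_exp ((- t) \<cdot>\<^sub>m (L3 N)\<^sup>T)) $$ (?i, ?i) =
      (\<Sum>p=1..N. \<Sum>q=1..N. \<Sum>r=1..N. (response p q r n m l t)\<^sup>2)" for t
  proof -
    define E where "E = mat_exp ((- t) \<cdot>\<^sub>m L3 N)"
    have E: "E \<in> carrier_mat (N ^ 3) (N ^ 3)"
      using L by (auto simp: E_def mat_exp_def)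
    have "(- t) \<cdot>\<^sub>m (L3 N)\<^sup>T = ((- t) \<cdot>\<^sub>m L3 N)\<^sup>T"
      by (intro eq_matI) simp_all
    then have "mat_exp ((- t) \<cdot>\<^sub>m (L3 N)\<^sup>T) = E\<^sup>T"
      using mat_exp_transpose[of "(- t) \<cdot>\<^sub>m L3 N" "N ^ 3"] L by (simp add: E_def)
    moreover have "(E * E\<^sup>T) $$ (?i, ?i) = (\<Sum>j<N ^ 3. (E $$ (?i, j))\<^sup>2)"
      using E i by (simp add: scalar_prod_def lessThan_atLeast0 power2_eq_square)
    ultimately have "(mat_exp ((- t) \<cdot>\<^sub>m L3 N) * mat_exp ((- t) \<cdot>\<^sub>m (L3 N)\<^sup>T)) $$ (?i, ?i) =
        (\<Sum>p=1..N. \<Sum>q=1..N. \<Sum>r=1..N. (E $$ (?i, stacked_index N p q r))\<^sup>2)"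
      by (simp add: E_def sum_stacked_index)
    also have "\<dots> = (\<Sum>p=1..N. \<Sum>q=1..N. \<Sum>r=1..N. (response p q r n m l t)\<^sup>2)"
      unfolding E_def by (intro sum.cong refl) (simp only: mat_exp_L3_entry[OF nml])
    finally show ?thesis .
  qed
  have "((\<lambda>t. \<Sum>p=1..N. \<Sum>q=1..N. \<Sum>r=1..N. (response p q r n m l t)\<^sup>2) has_integral ?V) {0..}"
    by (intro has_integral_sum has_integral_response_squared finite_atLeastAtMost)
  then show ?thesis
    using i L by (simp only: steady_state_cov_def integrand carrier_matD index_mat split integral_unique)
qed

section \<open>Counting the sources by distance\<close>

lemma sum_upto_by_distance:
  fixes f :: "nat \<Rightarrow> 'a :: comm_monoid_add"
  assumes "n \<le> N"
  shows "(\<Sum>p=1..N. if p \<le> n then f (n - p) else 0) = (\<Sum>i=1..n. f (i - 1))"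
proof -
  have "(\<Sum>p=1..N. if p \<le> n then f (n - p) else 0) = (\<Sum>p\<in>{1..n}. f (n - p))"
    using assms by (intro sum.mono_neutral_cong_right) auto
  also have "\<dots> = (\<Sum>i=1..n. f (i - 1))"
    by (rule sum.reindex_bij_witness[of _ "\<lambda>i. Suc n - i" "\<lambda>p. Suc n - p"]) auto
  finally show ?thesis .
qed

lemma sum_source_variance:
  assumes "n \<le> N" "m \<le> N" "l \<le> N"
  shows "(\<Sum>p=1..N. \<Sum>q=1..N. \<Sum>r=1..N.
      if p \<le> n \<and> q \<le> m \<and> r \<le> l then source_variance (n - p) (m - q) (l - r) else 0) =
    (\<Sum>i=1..n. \<Sum>j=1..m. \<Sum>k=1..l. source_variance (i - 1) (j - 1) (k - 1))"
proof -
  have "(\<Sum>p=1..N. \<Sum>q=1..N. \<Sum>r=1..N.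
      if p \<le> n \<and> q \<le> m \<and> r \<le> l then source_variance (n - p) (m - q) (l - r) else 0) =
    (\<Sum>p=1..N. if p \<le> n then (\<Sum>q=1..N. if q \<le> m then (\<Sum>r=1..N.
      if r \<le> l then source_variance (n - p) (m - q) (l - r) else 0) else 0) else 0)"
    by (auto intro!: sum.cong)
  also have "\<dots> = (\<Sum>i=1..n. \<Sum>j=1..m. \<Sum>k=1..l. source_variance (i - 1) (j - 1) (k - 1))"
    by (simp only:
        sum_upto_by_distance[OF assms(1),
          of "\<lambda>a. \<Sum>j=1..m. \<Sum>k=1..l. source_variance a (j - 1) (k - 1)"]
        sum_upto_by_distance[OF assms(2), of "\<lambda>b. \<Sum>k=1..l. source_variance a b (k - 1)" for a]
        sum_upto_by_distance[OF assms(3), of "\<lambda>c. source_variance a b c" for a b])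
  finally show ?thesis .
qed

lemma source_variance_eq:
  assumes "i \<ge> 1" "j \<ge> 1" "k \<ge> 1"
  shows "source_variance (i - 1) (j - 1) (k - 1) =
    6 powi (6 - (2 * int i + 2 * int j + 2 * int k)) * fact (2 * i + 2 * j + 2 * k - 6)
      / (6 * (fact (i - 1) * fact (j - 1) * fact (k - 1))\<^sup>2)"
proof -
  define d where "d = 2 * ((i - 1) + (j - 1) + (k - 1))"
  have exponents: "6 - (2 * int i + 2 * int j + 2 * int k) = - int d" "2 * i + 2 * j + 2 * k - 6 = d"
    using assms by (auto simp: d_def)
  have "source_variance (i - 1) (j - 1) (k - 1) =
      fact d / (6 ^ (d + 1) * (fact (i - 1) * fact (j - 1) * fact (k - 1))\<^sup>2)"
    by (simp only: source_variance_def d_def)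
  then show ?thesis
    unfolding exponents by (simp add: power_int_minus divide_simps)
qed

theorem lemma3:
  fixes N n m l :: nat and P :: "real mat"
  assumes "N \<ge> 1"
    and "P = steady_state_cov (L3 N)"
    and "n \<in> {1..N}" "m \<in> {1..N}" "l \<in> {1..N}"
  shows "diag_elem (diag_block N (diag_block (N\<^sup>2) P n) m) l =
    (\<Sum>i=1..n. \<Sum>j=1..m. \<Sum>k=1..l.
       6 powi (6 - (2 * int i + 2 * int j + 2 * int k)) * fact (2 * i + 2 * j + 2 * k - 6)
         / (6 * (fact (i - 1) * fact (j - 1) * fact (k - 1))\<^sup>2))"
proof -
  have "diag_elem (diag_block N (diag_block (N\<^sup>2) P n) m) l =
      (\<Sum>i=1..n. \<Sum>j=1..m. \<Sum>k=1..l. source_variance (i - 1) (j - 1) (k - 1))"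
    using assms
    by (simp only: diag_elem_diag_block steady_state_cov_L3_diag sum_source_variance
        atLeastAtMost_iff)
  also have "\<dots> = (\<Sum>i=1..n. \<Sum>j=1..m. \<Sum>k=1..l.
       6 powi (6 - (2 * int i + 2 * int j + 2 * int k)) * fact (2 * i + 2 * j + 2 * k - 6)
         / (6 * (fact (i - 1) * fact (j - 1) * fact (k - 1))\<^sup>2))"
    by (intro sum.cong refl source_variance_eq) auto
  finally show ?thesis .
qed

end
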